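(* $BQC(HAM_n^{n/2})=\Omega(n/\log n)$.
   Context: For even $n$ and $x,y\in\{0,1\}^n$, $HAM^t_n(x,y)=1$ iff $\sum_{i=1}^n(x_i\oplus y_i)\neq t$. Quantum communication model (Yao, no prior entanglement): Alice receives $x$, Bob $y$; each holds private qubits initialized to the input and $|0\rangle$; in each round one player applies a unitary to his qubits and sends one qubit; at the end a qubit is measured giving the output; the cost is the number of qubits exchanged. $BQC(f)$ is the minimum cost of a quantum protocol computing $f$ with error probability at most $1/3$ on every input. *)

theory Defs
  imports Complex_Main
begin

definition HAM :: "nat \<Rightarrow> nat \<Rightarrow> bool list \<Rightarrow> bool list \<Rightarrow> bool" where
  "HAM n t x y = (card {i. i < n \<and> x ! i \<noteq> y ! i} \<noteq> t)"

text \<open>Computational basis states of N qubits numbered 0..N-1 are the subsets of {0..<N}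
(the set of qubits in state 1). A state is an amplitude function; an operator is given
by its matrix entries U z y = <z|U|y>.\<close>

type_synonym qstate = "nat set \<Rightarrow> complex"
type_synonym qop = "nat set \<Rightarrow> nat set \<Rightarrow> complex"

definition basis_states :: "nat \<Rightarrow> nat set set" where
  "basis_states N = Pow {0..<N}"

definition apply_op :: "nat \<Rightarrow> qop \<Rightarrow> qstate \<Rightarrow> qstate" where
  "apply_op N U \<psi> = (\<lambda>z. \<Sum>y\<in>basis_states N. U z y * \<psi> y)"

definition unitary_op :: "nat \<Rightarrow> qop \<Rightarrow> bool" where
  "unitary_op N U \<longleftrightarrow> (\<forall>x\<in>basis_states N. \<forall>y\<in>basis_states N.
      (\<Sum>z\<in>basis_states N. cnj (U z x) * U z y) = (if x = y then 1 else 0))"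

text \<open>U acts only on the qubits in S, i.e. U = u \<otimes> Id on the remaining qubits.\<close>
definition acts_on :: "nat \<Rightarrow> nat set \<Rightarrow> qop \<Rightarrow> bool" where
  "acts_on N S U \<longleftrightarrow> (\<exists>u. \<forall>z\<in>basis_states N. \<forall>y\<in>basis_states N.
      U z y = (if z - S = y - S then u (z \<inter> S) (y \<inter> S) else 0))"

definition basis_vec :: "nat set \<Rightarrow> qstate" where
  "basis_vec s = (\<lambda>z. if z = s then 1 else 0)"

text \<open>A round (p, U, q): player p (True = Alice, False = Bob) applies the unitary U to
the qubits he currently holds and then sends the qubit q (one he holds) to the other
player. A protocol for inputs of length n uses N qubits in total: qubits 0..<n hold
Alice's input, qubits n..<2n hold Bob's input, all others are workspace qubits
initialised to |0>; alice0 is the set of qubits Alice initially holds (Bob holds the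
rest); at the end qubit meas is measured in the computational basis.\<close>

type_synonym qround = "bool \<times> qop \<times> nat"

record protocol =
  nqubits :: nat
  alice0 :: "nat set"
  rounds :: "qround list"
  meas :: nat

fun valid_rounds :: "nat \<Rightarrow> nat set \<Rightarrow> qround list \<Rightarrow> bool" where
  "valid_rounds N A [] = True"
| "valid_rounds N A ((p, U, q) # rs) =
     (let S = (if p then A else {0..<N} - A) in
        unitary_op N U \<and> acts_on N S U \<and> q \<in> S \<and>
        valid_rounds N (if p then A - {q} else insert q A) rs)"

fun run_rounds :: "nat \<Rightarrow> qround list \<Rightarrow> qstate \<Rightarrow> qstate" where
  "run_rounds N [] \<psi> = \<psi>"
| "run_rounds N ((p, U, q) # rs) \<psi> = run_rounds N rs (apply_op N U \<psi>)"

definition wf_protocol :: "nat \<Rightarrow> protocol \<Rightarrow> bool" where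
  "wf_protocol n P \<longleftrightarrow>
     2 * n \<le> nqubits P \<and> alice0 P \<subseteq> {0..<nqubits P} \<and>
     {0..<n} \<subseteq> alice0 P \<and> alice0 P \<inter> {n..<2*n} = {} \<and>
     meas P < nqubits P \<and> valid_rounds (nqubits P) (alice0 P) (rounds P)"

definition init_state :: "nat \<Rightarrow> bool list \<Rightarrow> bool list \<Rightarrow> qstate" where
  "init_state n x y = basis_vec ({i. i < n \<and> x ! i} \<union> {n + i | i. i < n \<and> y ! i})"

definition final_state :: "nat \<Rightarrow> protocol \<Rightarrow> bool list \<Rightarrow> bool list \<Rightarrow> qstate" where
  "final_state n P x y = run_rounds (nqubits P) (rounds P) (init_state n x y)"

definition prob_output :: "nat \<Rightarrow> protocol \<Rightarrow> bool list \<Rightarrow> bool list \<Rightarrow> bool \<Rightarrow> real" where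
  "prob_output n P x y b =
     (\<Sum>z\<in>{z\<in>basis_states (nqubits P). (meas P \<in> z) = b}. (cmod (final_state n P x y z))\<^sup>2)"

definition cost :: "protocol \<Rightarrow> nat" where
  "cost P = length (rounds P)"

definition computes :: "nat \<Rightarrow> protocol \<Rightarrow> (bool list \<Rightarrow> bool list \<Rightarrow> bool) \<Rightarrow> bool" where
  "computes n P f \<longleftrightarrow> wf_protocol n P \<and>
     (\<forall>x y. length x = n \<longrightarrow> length y = n \<longrightarrow> prob_output n P x y (\<not> f x y) \<le> 1/3)"

definition BQC :: "nat \<Rightarrow> (bool list \<Rightarrow> bool list \<Rightarrow> bool) \<Rightarrow> nat" where
  "BQC n f = (LEAST k. \<exists>P. computes n P f \<and> cost P = k)"

end

theory Submission
  imports Defs "HOL-Computational_Algebra.Polynomial"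
begin

text \<open>
  After \<open>c\<close> exchanged qubits the joint state is a sum of \<open>2 ^ c\<close> product vectors, one factor
  depending on \<open>x\<close> and the other on \<open>y\<close>, so each output probability is a sum of \<open>4 ^ c\<close> rank-one
  matrices with entries bounded by 1. Instead of repeating the protocol, the error is reduced to
  \<open>1 / poly n\<close> by applying entrywise the polynomial ``majority of \<open>2 e\<close> trials'' with \<open>e = O(log n)\<close>;
  this leaves \<open>(2 * 4 ^ c) ^ (2 e)\<close> rank-one matrices. The resulting matrix approximates
  the indicator of Hamming distance \<open>m = n / 2\<close>. Test it against \<open>W (x \<oplus> y)\<close>, where \<open>W\<close> is the sum
  of all characters of degree \<open>2 j\<close>, \<open>j = m div 2\<close>: by Parseval a bounded rank-one matrix has mean
  correlation at most 1 with it, while \<open>W\<close> equals \<open>(-1) ^ j * (m choose j)\<close>, about \<open>2 ^ m\<close> up to a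
  polynomial factor, on the whole middle layer. Hence \<open>(2 * 4 ^ c) ^ (2 e) \<ge> 2 ^ m / poly n\<close>.
\<close>

section \<open>Characters of the cube\<close>

text \<open>Points of the cube are encoded as subsets of \<open>{..<n}\<close>, so that bitwise XOR
  becomes \<open>sym_diff\<close>; this is the Walsh character, with index and argument in symmetric
  roles.\<close>

definition chi :: "nat set \<Rightarrow> nat set \<Rightarrow> real" where
  "chi R S = (-1) ^ card (R \<inter> S)"

lemma chi_commute: "chi R S = chi S R"
  by (simp add: chi_def Int_commute)

lemma chi_eq_prod:
  assumes "finite R"
  shows "chi R S = (\<Prod>i\<in>R. if i \<in> S then -1 else 1)"
proof -
  have "(\<Prod>i\<in>R. if i \<in> S then -1 else 1 :: real) = (\<Prod>i\<in>R \<inter> S. -1)"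
    by (rule prod.inter_restrict[OF assms, symmetric])
  then show ?thesis by (simp add: chi_def)
qed

lemma chi_sym_diff:
  assumes "finite R"
  shows "chi R (sym_diff S T) = chi R S * chi R T"
  unfolding chi_eq_prod[OF assms] prod.distrib[symmetric]
  by (rule prod.cong) auto

text \<open>The sum factorises over coordinates: \<open>i \<in> S\<close> contributes
  \<open>-1 + 1 = 0\<close>, any other coordinate contributes 2.\<close>

lemma sum_chi:
  assumes "S \<subseteq> {..<n}"
  shows "(\<Sum>R\<in>Pow {..<n}. chi R S) = (if S = {} then 2 ^ n else 0)"
proof -
  have "(\<Sum>R\<in>Pow {..<n}. chi R S) = (\<Sum>R\<in>Pow {..<n}. (\<Prod>i\<in>R. if i \<in> S then -1 else 1) * (\<Prod>i\<in>{..<n} - R. 1))"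
    by (rule sum.cong) (auto simp: chi_eq_prod finite_subset)
  also have "\<dots> = (\<Prod>i<n. (if i \<in> S then -1 else 1) + 1)"
    by (subst prod_add) auto
  also have "\<dots> = (if S = {} then 2 ^ n else 0)"
    using assms by auto
  finally show ?thesis .
qed

lemma sum_chi_mult:
  assumes "S \<subseteq> {..<n}" "T \<subseteq> {..<n}"
  shows "(\<Sum>R\<in>Pow {..<n}. chi R S * chi R T) = (if S = T then 2 ^ n else 0)"
proof -
  have "(\<Sum>R\<in>Pow {..<n}. chi R S * chi R T) = (\<Sum>R\<in>Pow {..<n}. chi R (sym_diff S T))"
    by (rule sum.cong) (auto simp: chi_sym_diff finite_subset)
  also have "\<dots> = (if sym_diff S T = {} then 2 ^ n else 0)"
    by (rule sum_chi) (use assms in auto)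
  also have "sym_diff S T = {} \<longleftrightarrow> S = T" by auto
  finally show ?thesis .
qed

text \<open>Expanding the square and summing over \<open>R\<close> first, orthogonality of
  characters leaves only the diagonal terms.\<close>

lemma parseval_chi:
  fixes a :: "nat set \<Rightarrow> complex"
  shows "(\<Sum>R\<in>Pow {..<n}. (cmod (\<Sum>S\<in>Pow {..<n}. a S * chi R S))\<^sup>2)
       = 2 ^ n * (\<Sum>S\<in>Pow {..<n}. (cmod (a S))\<^sup>2)"
proof -
  let ?P = "Pow {..<n}"
  have "complex_of_real (\<Sum>R\<in>?P. (cmod (\<Sum>S\<in>?P. a S * chi R S))\<^sup>2)
      = (\<Sum>R\<in>?P. (\<Sum>S\<in>?P. a S * chi R S) * (\<Sum>T\<in>?P. cnj (a T) * chi R T))"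
    by (simp add: complex_norm_square del: of_real_power)
  also have "\<dots> = (\<Sum>R\<in>?P. \<Sum>S\<in>?P. \<Sum>T\<in>?P. a S * cnj (a T) * of_real (chi R S * chi R T))"
    by (simp add: sum_product mult_ac)
  also have "\<dots> = (\<Sum>S\<in>?P. \<Sum>T\<in>?P. \<Sum>R\<in>?P. a S * cnj (a T) * of_real (chi R S * chi R T))"
    by (subst sum.swap) (intro sum.cong refl sum.swap)
  also have "\<dots> = (\<Sum>S\<in>?P. \<Sum>T\<in>?P. a S * cnj (a T) * of_real (\<Sum>R\<in>?P. chi R S * chi R T))"
    by (simp add: sum_distrib_left)
  also have "\<dots> = (\<Sum>S\<in>?P. \<Sum>T\<in>?P. if S = T then a S * cnj (a S) * 2 ^ n else 0)"
    by (intro sum.cong refl) (simp add: sum_chi_mult del: of_real_sum of_real_mult)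
  also have "\<dots> = (\<Sum>S\<in>?P. a S * cnj (a S) * 2 ^ n)"
    by (intro sum.cong refl) (simp add: sum.delta)
  also have "\<dots> = complex_of_real (2 ^ n * (\<Sum>S\<in>?P. (cmod (a S))\<^sup>2))"
    by (simp add: complex_norm_square sum_distrib_left mult_ac del: of_real_power, simp)
  finally show ?thesis unfolding of_real_eq_iff .
qed

text \<open>The Krawtchouk polynomial of degree \<open>k\<close>, evaluated at \<open>card Z\<close>.\<close>
definition kraw :: "nat \<Rightarrow> nat \<Rightarrow> nat set \<Rightarrow> real" where
  "kraw n k Z = (\<Sum>R\<in>{R\<in>Pow {..<n}. card R = k}. chi R Z)"

text \<open>Multiplicativity of characters makes this matrix diagonal in the Fourier basis,
  supported on level \<open>k\<close>.\<close>

lemma kraw_sym_diff: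
  "kraw n k (sym_diff S T) = (\<Sum>R\<in>{R\<in>Pow {..<n}. card R = k}. chi R S * chi R T)"
  unfolding kraw_def by (rule sum.cong) (auto simp: chi_sym_diff finite_subset)

lemma bij_betw_sym_diff: "S \<subseteq> U \<Longrightarrow> bij_betw (sym_diff S) (Pow U) (Pow U)"
  by (rule bij_betw_byWitness[where f' = "sym_diff S"]) auto

text \<open>Orthogonality again: each of the \<open>n choose k\<close> characters has squared norm
  \<open>2 ^ n\<close>. This second moment later controls the mean absolute value of the
  witness.\<close>

lemma sum_kraw_square:
  "(\<Sum>Z\<in>Pow {..<n}. (kraw n k Z)\<^sup>2) = 2 ^ n * real (n choose k)"
proof -
  let ?P = "Pow {..<n}" and ?L = "{R\<in>Pow {..<n}. card R = k}"
  have "(\<Sum>Z\<in>?P. (kraw n k Z)\<^sup>2) = (\<Sum>Z\<in>?P. \<Sum>R\<in>?L. \<Sum>R'\<in>?L. chi R Z * chi R' Z)"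
    by (simp add: kraw_def power2_eq_square sum_product)
  also have "\<dots> = (\<Sum>R\<in>?L. \<Sum>R'\<in>?L. \<Sum>Z\<in>?P. chi Z R * chi Z R')"
    unfolding sum.swap[of _ _ ?P] by (simp only: chi_commute)
  also have "\<dots> = (\<Sum>R\<in>?L. \<Sum>R'\<in>?L. if R = R' then 2 ^ n else 0)"
    by (intro sum.cong refl) (simp add: sum_chi_mult)
  also have "\<dots> = (\<Sum>R\<in>?L. 2 ^ n)"
    by (intro sum.cong refl) (simp add: sum.delta)
  also have "\<dots> = 2 ^ n * real (card {R. R \<subseteq> {..<n} \<and> card R = k})"
    by (simp add: Pow_def)
  also have "card {R. R \<subseteq> {..<n} \<and> card R = k} = n choose k"
    by (simp add: n_subsets)
  finally show ?thesis .
qed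

text \<open>Generating function: the sum of \<open>t ^ card R * chi R Z\<close> over all \<open>R\<close> is
  \<open>(1 - t) ^ m * (1 + t) ^ m = (1 - t\<^sup>2) ^ m\<close>.\<close>
lemma kraw_middle:
  assumes Z: "Z \<subseteq> {..<2 * m}" and card: "card Z = m"
  shows "kraw (2 * m) (2 * j) Z = (-1) ^ j * real (m choose j)"
proof -
  let ?U = "{..<2 * m}"
  let ?s = "\<lambda>i. if i \<in> Z then -1 else 1 :: real"
  \<comment> \<open>\<open>[:0, ?s i:]\<close> is the signed variable, so the degree of a product of
    these factors counts the elements of \<open>R\<close> and its coefficient is the
    character.\<close>
  have mon: "(\<Prod>i\<in>R. [:0, ?s i:]) = monom (chi R Z) (card R)" if "finite R" for R
    unfolding chi_eq_prod[OF that]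
    using that by (induction R rule: finite_induct) (simp_all add: mult_monom monom_Suc monom_0 mult.commute smult_monom)
  have "(\<Prod>i\<in>?U. [:0, ?s i:] + 1) = (\<Sum>R\<in>Pow ?U. monom (chi R Z) (card R))"
    by (subst prod_add) (auto intro!: sum.cong simp: mon finite_subset)
  then have "coeff (\<Prod>i\<in>?U. [:0, ?s i:] + 1) (2 * j) = (\<Sum>R\<in>Pow ?U. if card R = 2 * j then chi R Z else 0)"
    by (simp add: coeff_sum)
  also have "\<dots> = kraw (2 * m) (2 * j) Z"
    unfolding kraw_def by (rule sum.inter_filter[symmetric]) simp
  finally have 1: "kraw (2 * m) (2 * j) Z = coeff (\<Prod>i\<in>?U. [:0, ?s i:] + 1) (2 * j)" ..
  \<comment> \<open>On the middle layer the factors \<open>1 + t\<close> (outside \<open>Z\<close>)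
    and \<open>1 - t\<close> (inside \<open>Z\<close>) occur equally often and pair up to
    \<open>1 - t ^ 2\<close>.\<close>
  have "(\<Prod>i\<in>?U. [:0, ?s i:] + 1) = (\<Prod>i\<in>?U - Z. [:0, ?s i:] + 1) * (\<Prod>i\<in>Z. [:0, ?s i:] + 1)"
    using Z by (intro prod.subset_diff) auto
  also have "(\<Prod>i\<in>?U - Z. [:0, ?s i:] + 1) = (\<Prod>i\<in>?U - Z. [:1, 1:])"
    by (rule prod.cong) (auto simp: one_pCons)
  also have "\<dots> = [:1, 1:] ^ m"
    using Z card by (simp add: card_Diff_subset finite_subset)
  also have "(\<Prod>i\<in>Z. [:0, ?s i:] + 1) = (\<Prod>i\<in>Z. [:1, -1:])"
    by (rule prod.cong) (auto simp: one_pCons)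
  also have "\<dots> = [:1, -1:] ^ m" using card by simp
  also have "[:1, 1:] ^ m * [:1, -1:] ^ m = (monom (-1) 2 + 1 :: real poly) ^ m"
    by (simp add: power_mult_distrib[symmetric] monom_altdef numeral_2_eq_2 one_pCons)
  also have "\<dots> = (\<Sum>i\<le>m. monom (real (m choose i) * (-1) ^ i) (2 * i))"
    by (simp add: binomial_ring monom_power of_nat_poly smult_monom mult.commute)
  finally show ?thesis unfolding 1
    by (simp add: coeff_sum sum.delta binomial_eq_0 not_le mult.commute)
qed

text \<open>In the Vandermonde sum every product is at most the square of the central coefficient,
  and there are at most \<open>m + 1\<close> products.\<close>

lemma choose_double_le:
  "real (2 * m choose (2 * (m div 2))) \<le> real (Suc m) * (real (m choose (m div 2)))\<^sup>2"
proof -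
  let ?k = "2 * (m div 2)" and ?C = "m choose (m div 2)"
  have "(2 * m choose ?k) = (\<Sum>i\<le>?k. (m choose i) * (m choose (?k - i)))"
    using vandermonde[of m m ?k] by (simp add: mult_2)
  also have "\<dots> \<le> (\<Sum>i\<le>?k. ?C * ?C)"
    by (intro sum_mono mult_mono binomial_maximum) auto
  also have "\<dots> \<le> Suc m * ?C ^ 2" by (simp add: power2_eq_square)
  finally show ?thesis by (metis of_nat_le_iff of_nat_mult of_nat_power)
qed

section \<open>Sums of bounded rank-one matrices\<close>

text \<open>Terms with normalised factors are counted, instead of taking the rank, because the
  correlation bound against the witness needs entries bounded by 1.\<close>

inductive rect_rep :: "nat \<Rightarrow> ('a \<Rightarrow> 'b \<Rightarrow> complex) \<Rightarrow> bool" where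
  zero: "rect_rep 0 (\<lambda>x y. 0)"
| add: "rect_rep K F \<Longrightarrow> (\<And>x. cmod (a x) \<le> 1) \<Longrightarrow> (\<And>y. cmod (b y) \<le> 1) \<Longrightarrow>
    rect_rep (Suc K) (\<lambda>x y. F x y + a x * b y)"

lemma rect_rep_rank_one:
  "(\<And>x. cmod (a x) \<le> 1) \<Longrightarrow> (\<And>y. cmod (b y) \<le> 1) \<Longrightarrow> rect_rep 1 (\<lambda>x y. a x * b y)"
  using rect_rep.add[OF rect_rep.zero, of a b] by simp

lemma rect_rep_add:
  assumes "rect_rep K F" "rect_rep L G"
  shows "rect_rep (K + L) (\<lambda>x y. F x y + G x y)"
  using assms(2,1)
proof (induction rule: rect_rep.induct)
  case (add L G a b)
  from rect_rep.add[OF add.IH[OF add.prems] add.hyps(2,3)]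
  show ?case by (simp add: add.assoc)
qed simp

lemma rect_rep_mult_rank_one:
  assumes "rect_rep K F" "\<And>x. cmod (a x) \<le> 1" "\<And>y. cmod (b y) \<le> 1"
  shows "rect_rep K (\<lambda>x y. F x y * (a x * b y))"
  using assms(1)
proof (induction rule: rect_rep.induct)
  case zero
  then show ?case by (simp add: rect_rep.zero)
next
  case (add K F a' b')
  have "rect_rep (Suc K) (\<lambda>x y. F x y * (a x * b y) + (a' x * a x) * (b' y * b y))"
    using assms(2,3) add.hyps(2,3)
    by (intro rect_rep.add add.IH) (auto simp: norm_mult intro: mult_le_one)
  then show ?case by (simp add: algebra_simps)
qed

text \<open>The entrywise product of two rank-one matrices has rank one again, so the product of the
  two sums distributes into \<open>K * L\<close> terms.\<close>

lemma rect_rep_mult: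
  assumes "rect_rep K F" "rect_rep L G"
  shows "rect_rep (K * L) (\<lambda>x y. F x y * G x y)"
  using assms(2,1)
proof (induction rule: rect_rep.induct)
  case zero
  then show ?case by (simp add: rect_rep.zero)
next
  case (add L G a b)
  from rect_rep_add[OF rect_rep_mult_rank_one[of K F a b, OF add.prems add.hyps(2,3)] add.IH[OF add.prems]]
  show ?case by (simp add: algebra_simps)
qed

lemma rect_rep_power:
  assumes "rect_rep K F"
  shows "rect_rep (K ^ k) (\<lambda>x y. F x y ^ k)"
proof (induction k)
  case 0
  show ?case using rect_rep_rank_one[of "\<lambda>_. 1" "\<lambda>_. 1"] by simp
next
  case (Suc k)
  show ?case using rect_rep_mult[OF assms Suc] by simp
qed

text \<open>A coefficient above 1 cannot be absorbed into the factors, so it is paid for by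
  repeating terms.\<close>

lemma rect_rep_of_nat_mult:
  assumes "rect_rep K F"
  shows "rect_rep (c * K) (\<lambda>x y. of_nat c * F x y)"
proof (induction c)
  case 0
  then show ?case by (simp add: rect_rep.zero)
next
  case (Suc c)
  then show ?case using rect_rep_add[OF assms Suc] by (simp add: algebra_simps)
qed

lemma rect_rep_sum:
  assumes "finite I" "\<And>i. i \<in> I \<Longrightarrow> rect_rep (K i) (F i)"
  shows "rect_rep (\<Sum>i\<in>I. K i) (\<lambda>x y. \<Sum>i\<in>I. F i x y)"
  using assms
proof (induction I rule: finite_induct)
  case empty
  then show ?case by (simp add: rect_rep.zero)
next
  case (insert i I)
  then show ?case using rect_rep_add[of "K i" "F i"] by simp
qed

section \<open>Correlation of bounded rank-one matrices with Krawtchouk polynomials\<close>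

lemma mult_le_half_sum_squares: "a * b \<le> (a\<^sup>2 + b\<^sup>2) / (2 :: real)"
  using sum_squares_bound[of a b] by simp

text \<open>By diagonalisation the sum is the pairing of the Fourier coefficients of
  \<open>a\<close> and \<open>b\<close> on level \<open>k\<close>. The arithmetic-geometric mean
  inequality reduces it to the two full squared norms, each at most \<open>2 ^ n * 2 ^ n\<close> by
  Parseval.\<close>

lemma rank_one_kraw_bound:
  fixes a b :: "nat set \<Rightarrow> complex"
  assumes "\<And>S. cmod (a S) \<le> 1" "\<And>T. cmod (b T) \<le> 1"
  shows "cmod (\<Sum>S\<in>Pow {..<n}. \<Sum>T\<in>Pow {..<n}. a S * b T * kraw n k (sym_diff S T)) \<le> 4 ^ n"
proof -
  let ?P = "Pow {..<n}" and ?L = "{R\<in>Pow {..<n}. card R = k}"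
  define hat where "hat = (\<lambda>(f :: nat set \<Rightarrow> complex) R. \<Sum>S\<in>?P. f S * chi R S)"
  have hat_le: "(\<Sum>R\<in>?P. (cmod (hat f R))\<^sup>2) \<le> 4 ^ n" if "\<And>S. cmod (f S) \<le> 1" for f
  proof -
    have "(\<Sum>S\<in>?P. (cmod (f S))\<^sup>2) \<le> (\<Sum>S\<in>?P. 1)"
      by (intro sum_mono) (simp add: power_le_one that)
    also have "\<dots> = 2 ^ n" by (simp add: card_Pow)
    finally show ?thesis
      unfolding hat_def parseval_chi using power_mult_distrib[of "2 :: real" 2 n] by simp
  qed
  have "(\<Sum>S\<in>?P. \<Sum>T\<in>?P. a S * b T * kraw n k (sym_diff S T))
      = (\<Sum>S\<in>?P. \<Sum>T\<in>?P. \<Sum>R\<in>?L. (a S * chi R S) * (b T * chi R T))"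
    by (simp add: kraw_sym_diff sum_distrib_left mult_ac)
  also have "\<dots> = (\<Sum>R\<in>?L. hat a R * hat b R)"
    unfolding sum.swap[of _ _ ?L] hat_def sum_product ..
  also have "cmod \<dots> \<le> (\<Sum>R\<in>?L. cmod (hat a R) * cmod (hat b R))"
    by (rule order_trans[OF norm_sum]) (simp add: norm_mult)
  also have "\<dots> \<le> (\<Sum>R\<in>?P. cmod (hat a R) * cmod (hat b R))"
    by (rule sum_mono2) auto
  also have "\<dots> \<le> (\<Sum>R\<in>?P. ((cmod (hat a R))\<^sup>2 + (cmod (hat b R))\<^sup>2) / 2)"
    by (intro sum_mono mult_le_half_sum_squares)
  also have "\<dots> = ((\<Sum>R\<in>?P. (cmod (hat a R))\<^sup>2) + (\<Sum>R\<in>?P. (cmod (hat b R))\<^sup>2)) / 2"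
    by (simp add: sum.distrib sum_divide_distrib[symmetric])
  also have "\<dots> \<le> 4 ^ n"
    using hat_le[of a] hat_le[of b] assms by simp
  finally show ?thesis .
qed

lemma rect_rep_kraw_bound:
  assumes "rect_rep K F"
  shows "cmod (\<Sum>S\<in>Pow {..<n}. \<Sum>T\<in>Pow {..<n}. F S T * kraw n k (sym_diff S T)) \<le> real K * 4 ^ n"
  using assms
proof (induction rule: rect_rep.induct)
  case (add K F a b)
  have "cmod (\<Sum>S\<in>Pow {..<n}. \<Sum>T\<in>Pow {..<n}. (F S T + a S * b T) * kraw n k (sym_diff S T))
    \<le> cmod (\<Sum>S\<in>Pow {..<n}. \<Sum>T\<in>Pow {..<n}. F S T * kraw n k (sym_diff S T))
    + cmod (\<Sum>S\<in>Pow {..<n}. \<Sum>T\<in>Pow {..<n}. a S * b T * kraw n k (sym_diff S T))"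
    unfolding distrib_right sum.distrib by (rule norm_triangle_ineq)
  also have "\<dots> \<le> real K * 4 ^ n + 4 ^ n"
    by (intro add_mono add.IH rank_one_kraw_bound add.hyps(2,3))
  finally show ?case by (simp add: algebra_simps)
qed simp

text \<open>The mean absolute value is bounded through the second moment, which exceeds the squared
  value on the middle layer by a factor of at most \<open>m + 1\<close>.\<close>

lemma sum_abs_kraw_le:
  "(\<Sum>Z\<in>Pow {..<2 * m}. \<bar>kraw (2 * m) (2 * (m div 2)) Z\<bar>)
     \<le> 4 ^ m * (real (Suc m) * real (m choose (m div 2)))"
proof -
  let ?P = "Pow {..<2 * m}" and ?C = "real (m choose (m div 2))"
  let ?w = "kraw (2 * m) (2 * (m div 2))"
  have C: "?C > 0" by simp
  \<comment> \<open>The weight in the arithmetic-geometric mean inequality. With this choice the sum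
    of \<open>w ^ 2 / s\<close> is at most \<open>4 ^ m * ?C\<close>, and no square root of
    \<open>m + 1\<close> appears.\<close>
  define s where "s = real (Suc m) * ?C"
  have s: "s > 0" using C by (simp add: s_def)
  have "\<bar>w\<bar> \<le> (w\<^sup>2 / s + s) / 2" for w :: real
    using sum_squares_bound[of "\<bar>w\<bar>" s] s by (simp add: field_simps power2_eq_square)
  then have "(\<Sum>Z\<in>?P. \<bar>?w Z\<bar>) \<le> (\<Sum>Z\<in>?P. ((?w Z)\<^sup>2 / s + s) / 2)"
    by (intro sum_mono)
  also have "\<dots> = ((\<Sum>Z\<in>?P. (?w Z)\<^sup>2) / s + 4 ^ m * s) / 2"
    by (simp add: sum.distrib sum_divide_distrib[symmetric] card_Pow power_mult)
  also have "(\<Sum>Z\<in>?P. (?w Z)\<^sup>2) = 4 ^ m * real (2 * m choose (2 * (m div 2)))"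
    by (simp add: sum_kraw_square power_mult)
  also have "\<dots> / s \<le> 4 ^ m * (real (Suc m) * ?C\<^sup>2) / s"
    using choose_double_le[of m] s by (intro divide_right_mono mult_left_mono) auto
  also have "\<dots> = 4 ^ m * ?C"
    using C by (simp add: s_def power2_eq_square del: of_nat_Suc)
  also have "4 ^ m * ?C \<le> 4 ^ m * s"
    using C by (simp add: s_def)
  finally show ?thesis by (simp add: s_def mult_ac)
qed

lemma sum_middle_kraw:
  "(\<Sum>Z\<in>{Z\<in>Pow {..<2 * m}. card Z = m}. kraw (2 * m) (2 * j) Z)
     = (-1) ^ j * real (m choose j) * real (2 * m choose m)"
proof -
  have "(\<Sum>Z\<in>{Z\<in>Pow {..<2 * m}. card Z = m}. kraw (2 * m) (2 * j) Z)
      = (\<Sum>Z\<in>{Z. Z \<subseteq> {..<2 * m} \<and> card Z = m}. (-1) ^ j * real (m choose j))"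
    by (rule sum.cong) (auto simp: kraw_middle)
  also have "\<dots> = (-1) ^ j * real (m choose j) * real (2 * m choose m)"
    by (simp add: n_subsets)
  finally show ?thesis .
qed

text \<open>The Krawtchouk polynomial of degree about \<open>m\<close> is the dual witness: it correlates with the
  middle layer by about \<open>2 ^ m\<close>, while the mean of its absolute value is only polynomially larger
  and every bounded rank-one matrix correlates with it by at most 1 on average.\<close>
lemma middle_layer_rank_bound:
  fixes Q :: "nat set \<Rightarrow> nat set \<Rightarrow> real"
  assumes m: "m > 0" and rep: "rect_rep K (\<lambda>S T. complex_of_real (Q S T))"
    and approx: "\<And>S T. S \<subseteq> {..<2 * m} \<Longrightarrow> T \<subseteq> {..<2 * m} \<Longrightarrow>
      \<bar>Q S T - (if card (sym_diff S T) = m then 1 else 0)\<bar> \<le> \<epsilon>"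
    and \<epsilon>: "\<epsilon> * (4 * (real m + 1)\<^sup>2) \<le> 1"
  shows "2 ^ m \<le> 4 * (real m + 1)\<^sup>2 * real K"
proof -
  let ?P = "Pow {..<2 * m}" and ?C = "real (m choose (m div 2))"
  let ?w = "kraw (2 * m) (2 * (m div 2))"
  let ?h = "\<lambda>Z :: nat set. if card Z = m then 1 else 0 :: real"
  \<comment> \<open>\<open>G\<close> and \<open>H\<close> are the correlations of \<open>Q\<close>
    and of the exact indicator with the witness. \<open>H\<close> is computed exactly,
    \<open>G\<close> is bounded by the number of terms, and \<open>H - G\<close> by the
    approximation error.\<close>
  define G where "G = (\<Sum>S\<in>?P. \<Sum>T\<in>?P. Q S T * ?w (sym_diff S T))"
  define H where "H = (\<Sum>S\<in>?P. \<Sum>T\<in>?P. ?h (sym_diff S T) * ?w (sym_diff S T))"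
  \<comment> \<open>For fixed \<open>S\<close> the map \<open>T \<mapsto> sym_diff S T\<close>
    permutes the cube, so every \<open>S\<close> contributes the same inner sum.\<close>
  have shift: "(\<Sum>S\<in>?P. \<Sum>T\<in>?P. f (sym_diff S T)) = 4 ^ m * (\<Sum>Z\<in>?P. f Z)" for f :: "nat set \<Rightarrow> real"
  proof -
    have "(\<Sum>T\<in>?P. f (sym_diff S T)) = (\<Sum>Z\<in>?P. f Z)" if "S \<in> ?P" for S
      by (rule sum.reindex_bij_betw, rule bij_betw_sym_diff) (use that in auto)
    then show ?thesis by (simp add: card_Pow power_mult)
  qed
  have "(\<Sum>Z\<in>?P. ?h Z * ?w Z) = (\<Sum>Z\<in>?P. if card Z = m then ?w Z else 0)"
    by (rule sum.cong) auto
  also have "\<dots> = (\<Sum>Z\<in>{Z\<in>?P. card Z = m}. ?w Z)"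
    by (rule sum.inter_filter[symmetric]) simp
  finally have h: "\<bar>\<Sum>Z\<in>?P. ?h Z * ?w Z\<bar> = ?C * real (2 * m choose m)"
    unfolding sum_middle_kraw by (simp add: abs_mult power_abs)
  have "\<bar>\<Sum>S\<in>?P. \<Sum>T\<in>?P. Q S T * ?w (sym_diff S T)\<bar> = cmod (\<Sum>S\<in>?P. \<Sum>T\<in>?P. of_real (Q S T) * of_real (?w (sym_diff S T)))"
    unfolding of_real_mult[symmetric] of_real_sum[symmetric] norm_of_real ..
  also have "\<dots> \<le> real K * 4 ^ (2 * m)"
    by (rule rect_rep_kraw_bound[OF rep])
  finally have upper: "\<bar>G\<bar> \<le> real K * 4 ^ (2 * m)"
    unfolding G_def .
  have approx': "\<bar>?h (sym_diff S T) - Q S T\<bar> \<le> \<epsilon>" if "S \<in> ?P" "T \<in> ?P" for S T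
    using approx[of S T] that by (simp only: abs_minus_commute Pow_iff)
  have "\<bar>(\<Sum>S\<in>?P. \<Sum>T\<in>?P. ?h (sym_diff S T) * ?w (sym_diff S T)) - (\<Sum>S\<in>?P. \<Sum>T\<in>?P. Q S T * ?w (sym_diff S T))\<bar>
    = \<bar>\<Sum>S\<in>?P. \<Sum>T\<in>?P. (?h (sym_diff S T) - Q S T) * ?w (sym_diff S T)\<bar>"
    by (simp add: sum_subtractf left_diff_distrib)
  also have "\<dots> \<le> (\<Sum>S\<in>?P. \<Sum>T\<in>?P. \<epsilon> * \<bar>?w (sym_diff S T)\<bar>)"
    by (rule order_trans[OF sum_abs], rule sum_mono, rule order_trans[OF sum_abs], rule sum_mono)
      (simp only: abs_mult, intro mult_right_mono approx', auto)
  also have "\<dots> = \<epsilon> * (4 ^ m * (\<Sum>Z\<in>?P. \<bar>?w Z\<bar>))"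
    unfolding sum_distrib_left[symmetric] shift[of "\<lambda>Z. \<bar>?w Z\<bar>"] ..
  also have "\<dots> \<le> \<epsilon> * (4 ^ m * (4 ^ m * (real (Suc m) * ?C)))"
  proof (rule mult_left_mono)
    show "0 \<le> \<epsilon>" using approx[of "{}" "{}"] by simp
  qed (intro mult_left_mono sum_abs_kraw_le, simp)
  finally have diff: "\<bar>H - G\<bar> \<le> \<epsilon> * (4 ^ m * (4 ^ m * (real (Suc m) * ?C)))"
    unfolding H_def G_def .
  have "\<bar>H\<bar> = 4 ^ m * (?C * real (2 * m choose m))"
    unfolding H_def shift[of "\<lambda>Z. ?h Z * ?w Z"] abs_mult h by simp
  moreover have "\<bar>H\<bar> \<le> \<bar>G\<bar> + \<bar>H - G\<bar>" by simp
  then have "\<bar>H\<bar> \<le> real K * 4 ^ (2 * m) + \<epsilon> * (4 ^ m * (4 ^ m * (real (Suc m) * ?C)))"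
    by (rule order_trans) (rule add_mono[OF upper diff])
  moreover have "real K * 4 ^ (2 * m) + \<epsilon> * (4 ^ m * (4 ^ m * (real (Suc m) * ?C)))
      = 4 ^ m * (4 ^ m * (real K + \<epsilon> * (real (Suc m) * ?C)))"
    unfolding power_even_eq power2_eq_square by (simp only: distrib_left mult_ac)
  ultimately have "4 ^ m * (?C * real (2 * m choose m)) \<le> 4 ^ m * (4 ^ m * (real K + \<epsilon> * (real (Suc m) * ?C)))"
    by (simp only:)
  then have "?C * real (2 * m choose m) \<le> 4 ^ m * (K + \<epsilon> * (real (Suc m) * ?C))"
    by simp
  moreover have "?C * (4 ^ m / (2 * real m)) \<le> ?C * real (2 * m choose m)"
    using central_binomial_lower_bound[OF m] by (intro mult_left_mono) auto
  ultimately have "4 ^ m * (?C / (2 * real m)) \<le> 4 ^ m * (K + \<epsilon> * (real (Suc m) * ?C))"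
    by (simp add: mult_ac)
  then have 1: "?C / (2 * real m) \<le> real K + \<epsilon> * (real (Suc m) * ?C)"
    by (rule mult_left_le_imp_le) simp
  \<comment> \<open>The smallness of \<open>\<epsilon>\<close> makes the error at most half of
    \<open>?C / (2 * (real m + 1))\<close>, itself a lower bound for the main term.\<close>
  have "\<epsilon> * (real m + 1) \<le> 1 / (4 * (real m + 1))"
    using \<epsilon> by (simp add: field_simps power2_eq_square)
  then have "\<epsilon> * (real m + 1) * ?C \<le> 1 / (4 * (real m + 1)) * ?C"
    by (rule mult_right_mono) simp
  moreover have "?C / (2 * (real m + 1)) \<le> ?C / (2 * real m)"
    using m by (intro divide_left_mono) auto
  moreover have "?C / (2 * (real m + 1)) = 2 * (1 / (4 * (real m + 1)) * ?C)"
    by (simp add: field_simps)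
  moreover have "\<epsilon> * (real (Suc m) * ?C) = \<epsilon> * (real m + 1) * ?C"
    by (simp only: of_nat_Suc mult_ac add.commute)
  ultimately have "1 / (4 * (real m + 1)) * ?C \<le> real K"
    using 1 by linarith
  then have 2: "?C \<le> 4 * (real m + 1) * real K"
    by (simp add: field_simps)
  \<comment> \<open>The central coefficient is the largest of the \<open>m + 1\<close> entries of a
    row with sum \<open>2 ^ m\<close>.\<close>
  have "2 ^ m = (\<Sum>k\<le>m. real (m choose k))"
    by (metis choose_row_sum of_nat_numeral of_nat_power of_nat_sum)
  also have "\<dots> \<le> (\<Sum>k\<le>m. ?C)"
    by (intro sum_mono) (simp add: binomial_maximum)
  also have "\<dots> = (real m + 1) * ?C" by simp
  also have "\<dots> \<le> (real m + 1) * (4 * (real m + 1) * K)"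
    using 2 by (rule mult_left_mono) simp
  finally show ?thesis by (simp add: power2_eq_square mult_ac)
qed

section \<open>Error reduction\<close>

text \<open>For \<open>p + r = 1\<close> this is the probability of at least \<open>e\<close>
  successes in \<open>2 * e\<close> trials. Keeping \<open>r\<close> apart from \<open>1 - p\<close>
  makes it homogeneous with natural coefficients, which suits \<open>rect_rep\<close>.\<close>

definition majority_poly :: "nat \<Rightarrow> 'a \<Rightarrow> 'a \<Rightarrow> 'a :: comm_semiring_1" where
  "majority_poly e p r = (\<Sum>k\<in>{e..2 * e}. of_nat (2 * e choose k) * (p ^ k * r ^ (2 * e - k)))"

text \<open>Every monomial has degree \<open>2 * e\<close> and costs \<open>K ^ (2 * e)\<close>
  terms; the binomial coefficients add up to at most \<open>2 ^ (2 * e)\<close>.\<close>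

lemma rect_rep_majority_poly:
  assumes "rect_rep K F" "rect_rep K G"
  shows "\<exists>L \<le> (2 * K) ^ (2 * e). rect_rep L (\<lambda>x y. majority_poly e (F x y) (G x y))"
proof (intro exI conjI)
  show "rect_rep (\<Sum>k\<in>{e..2 * e}. (2 * e choose k) * (K ^ k * K ^ (2 * e - k)))
      (\<lambda>x y. majority_poly e (F x y) (G x y))"
    unfolding majority_poly_def
    by (intro rect_rep_sum rect_rep_of_nat_mult rect_rep_mult rect_rep_power assms) simp
  have "(\<Sum>k\<in>{e..2 * e}. (2 * e choose k) * (K ^ k * K ^ (2 * e - k)))
      = (\<Sum>k\<in>{e..2 * e}. (2 * e choose k)) * K ^ (2 * e)"
    unfolding sum_distrib_right by (rule sum.cong) (auto simp: power_add[symmetric])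
  also have "\<dots> \<le> (\<Sum>k\<le>2 * e. (2 * e choose k)) * K ^ (2 * e)"
    by (intro mult_right_mono sum_mono2) auto
  finally show "(\<Sum>k\<in>{e..2 * e}. (2 * e choose k) * (K ^ k * K ^ (2 * e - k))) \<le> (2 * K) ^ (2 * e)"
    by (simp add: choose_row_sum power_mult_distrib)
qed

text \<open>Since \<open>p \<le> r\<close>, each power product in the tail is at most
  \<open>(p * r) ^ e \<le> (2 / 9) ^ e\<close>. The coefficients sum to at most
  \<open>4 ^ e\<close>, and \<open>4 * 2 / 9 = 8 / 9\<close>.\<close>

lemma binomial_upper_tail_le:
  fixes p r :: real
  assumes "0 \<le> p" "p \<le> 1 / 3" "p + r = 1"
  shows "(\<Sum>k\<in>{e..2 * e}. real (2 * e choose k) * (p ^ k * r ^ (2 * e - k))) \<le> (8 / 9) ^ e"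
proof -
  have pr: "p \<le> r" "0 \<le> r" using assms by auto
  have "0 \<le> (1 / 3 - p) * (2 / 3 - p)" using assms by (intro mult_nonneg_nonneg) auto
  then have "p * (1 - p) \<le> 2 / 9" by (simp add: field_simps)
  moreover have "r = 1 - p" using assms by simp
  ultimately have "p * r \<le> 2 / 9" by simp
  then have "(p * r) ^ e \<le> (2 / 9) ^ e"
    using assms pr by (intro power_mono) auto
  have "p ^ k * r ^ (2 * e - k) \<le> (2 / 9) ^ e" if "k \<in> {e..2 * e}" for k
  proof -
    have "p ^ k * r ^ (2 * e - k) = p ^ e * (p ^ (k - e) * r ^ (2 * e - k))"
      using that by (simp add: power_add[symmetric] mult.assoc[symmetric])
    also have "\<dots> \<le> p ^ e * (r ^ (k - e) * r ^ (2 * e - k))"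
      using assms pr by (intro mult_left_mono mult_right_mono power_mono) auto
    also have "\<dots> = (p * r) ^ e"
      using that by (simp add: power_add[symmetric] power_mult_distrib)
    finally show ?thesis using \<open>(p * r) ^ e \<le> (2 / 9) ^ e\<close> by simp
  qed
  then have "(\<Sum>k\<in>{e..2 * e}. real (2 * e choose k) * (p ^ k * r ^ (2 * e - k)))
      \<le> (\<Sum>k\<in>{e..2 * e}. real (2 * e choose k) * (2 / 9) ^ e)"
    by (intro sum_mono mult_left_mono) auto
  also have "\<dots> \<le> (\<Sum>k\<le>2 * e. real (2 * e choose k) * (2 / 9) ^ e)"
    by (intro sum_mono2) auto
  also have "\<dots> = real (\<Sum>k\<le>2 * e. (2 * e choose k)) * (2 / 9) ^ e"
    by (simp add: sum_distrib_right)
  also have "\<dots> = (8 / 9) ^ e"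
    by (simp add: choose_row_sum power_mult power_mult_distrib[symmetric])
  finally show ?thesis .
qed

lemma majority_poly_nonneg: "0 \<le> p \<Longrightarrow> 0 \<le> r \<Longrightarrow> 0 \<le> majority_poly e p (r :: real)"
  unfolding majority_poly_def by (intro sum_nonneg) auto

lemma majority_poly_small:
  fixes p r :: real
  assumes "0 \<le> p" "p \<le> 1 / 3" "p + r = 1"
  shows "\<bar>majority_poly e p r\<bar> \<le> (8 / 9) ^ e"
  using majority_poly_nonneg[of p r e] binomial_upper_tail_le[OF assms, of e] assms
  by (simp add: majority_poly_def)

lemma majority_poly_large:
  fixes p r :: real
  assumes "0 \<le> r" "r \<le> 1 / 3" "p + r = 1"
  shows "\<bar>majority_poly e p r - 1\<bar> \<le> (8 / 9) ^ e"
proof -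
  let ?f = "\<lambda>k. real (2 * e choose k) * (p ^ k * r ^ (2 * e - k))"
  let ?g = "\<lambda>k. real (2 * e choose k) * (r ^ k * p ^ (2 * e - k))"
  have p: "0 \<le> p" using assms by simp
  have "1 = (\<Sum>k\<le>2 * e. ?f k)"
    using binomial_ring[of p r "2 * e"] assms by (simp add: mult.assoc)
  also have "\<dots> = (\<Sum>k\<in>{..<e}. ?f k) + (\<Sum>k\<in>{e..2 * e}. ?f k)"
    by (subst sum.union_disjoint[symmetric]) (auto intro: sum.cong)
  finally have 1: "1 - majority_poly e p r = (\<Sum>k\<in>{..<e}. ?f k)"
    by (simp add: majority_poly_def)
  \<comment> \<open>Counting failures instead of successes turns the lower tail into the strict
    upper tail with \<open>p\<close> and \<open>r\<close> exchanged.\<close>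
  have "(\<Sum>k\<in>{..<e}. ?f k) = (\<Sum>k\<in>{e<..2 * e}. ?g k)"
    by (rule sum.reindex_bij_witness[of _ "\<lambda>k. 2 * e - k" "\<lambda>k. 2 * e - k"])
      (auto simp: binomial_symmetric[symmetric] mult_ac)
  also have "\<dots> \<le> (\<Sum>k\<in>{e..2 * e}. ?g k)"
    using assms p by (intro sum_mono2) auto
  also have "\<dots> \<le> (8 / 9) ^ e"
    using assms by (intro binomial_upper_tail_le) auto
  finally have "(\<Sum>k\<in>{..<e}. ?f k) \<le> (8 / 9) ^ e" .
  moreover have "0 \<le> (\<Sum>k\<in>{..<e}. ?f k)"
    using assms p by (intro sum_nonneg) auto
  ultimately show ?thesis using 1 by simp
qed

section \<open>Decomposition of protocols\<close>

lemma finite_basis_states [simp]: "finite (basis_states N)"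
  by (simp add: basis_states_def)

text \<open>Tensor factorisation: a basis state of the qubits \<open>B\<close> is a pair of basis
  states of \<open>A\<close> and of \<open>B - A\<close>.\<close>

lemma sum_Pow_split:
  assumes "A \<subseteq> B" "finite B"
  shows "(\<Sum>z\<in>Pow B. f z) = (\<Sum>u\<in>Pow A. \<Sum>v\<in>Pow (B - A). f (u \<union> v))"
  unfolding sum.cartesian_product
  by (rule sum.reindex_bij_witness[of _ "\<lambda>(u, v). u \<union> v" "\<lambda>z. (z \<inter> A, z - A)"])
    (use assms in \<open>auto intro: arg_cong[where f = f]\<close>)

text \<open>The index set is arbitrary so that the result applies both to a unitary on all qubits
  and to its local factor on one player's qubits.\<close>

lemma isometry_norm:
  fixes U :: "'a \<Rightarrow> 'a \<Rightarrow> complex"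
  assumes "finite B"
    and iso: "\<And>x y. x \<in> B \<Longrightarrow> y \<in> B \<Longrightarrow> (\<Sum>z\<in>B. cnj (U z x) * U z y) = (if x = y then 1 else 0)"
  shows "(\<Sum>z\<in>B. (cmod (\<Sum>y\<in>B. U z y * f y))\<^sup>2) = (\<Sum>y\<in>B. (cmod (f y))\<^sup>2)"
proof -
  have "complex_of_real (\<Sum>z\<in>B. (cmod (\<Sum>y\<in>B. U z y * f y))\<^sup>2)
      = (\<Sum>z\<in>B. (\<Sum>y\<in>B. U z y * f y) * (\<Sum>x\<in>B. cnj (U z x) * cnj (f x)))"
    by (simp add: complex_norm_square del: of_real_power)
  also have "\<dots> = (\<Sum>z\<in>B. \<Sum>y\<in>B. \<Sum>x\<in>B. cnj (U z x) * U z y * (f y * cnj (f x)))"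
    by (simp add: sum_product mult_ac)
  also have "\<dots> = (\<Sum>y\<in>B. \<Sum>z\<in>B. \<Sum>x\<in>B. cnj (U z x) * U z y * (f y * cnj (f x)))"
    by (rule sum.swap)
  also have "\<dots> = (\<Sum>y\<in>B. \<Sum>x\<in>B. \<Sum>z\<in>B. cnj (U z x) * U z y * (f y * cnj (f x)))"
    by (intro sum.cong refl sum.swap)
  also have "\<dots> = (\<Sum>y\<in>B. \<Sum>x\<in>B. if y = x then f y * cnj (f y) else 0)"
    by (intro sum.cong refl) (simp add: sum_distrib_right[symmetric] iso)
  also have "\<dots> = (\<Sum>y\<in>B. f y * cnj (f y))"
    using assms(1) by (intro sum.cong refl) simp
  also have "\<dots> = complex_of_real (\<Sum>y\<in>B. (cmod (f y))\<^sup>2)"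
    by (simp add: complex_norm_square del: of_real_power)
  finally show ?thesis unfolding of_real_eq_iff .
qed

text \<open>\<open>sep N A K \<psi>\<close>: the family of states \<open>\<psi> x y\<close> is a sum of \<open>K\<close> products of a vector on the
  qubits \<open>A\<close> that depends on \<open>x\<close> only and a vector on the other qubits that depends on \<open>y\<close> only,
  all of norm at most 1.\<close>
inductive sep :: "nat \<Rightarrow> nat set \<Rightarrow> nat \<Rightarrow> ('a \<Rightarrow> 'b \<Rightarrow> qstate) \<Rightarrow> bool" for N A where
  zero: "(\<And>x y z. z \<subseteq> {0..<N} \<Longrightarrow> \<psi> x y z = 0) \<Longrightarrow> sep N A 0 \<psi>"
| add: "sep N A K \<phi> \<Longrightarrow> (\<And>x. (\<Sum>u\<in>Pow A. (cmod (a x u))\<^sup>2) \<le> 1) \<Longrightarrow>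
    (\<And>y. (\<Sum>v\<in>Pow ({0..<N} - A). (cmod (b y v))\<^sup>2) \<le> 1) \<Longrightarrow>
    (\<And>x y z. z \<subseteq> {0..<N} \<Longrightarrow> \<psi> x y z = \<phi> x y z + a x (z \<inter> A) * b y (z - A)) \<Longrightarrow>
    sep N A (Suc K) \<psi>"

text \<open>The two players are symmetric, so the effect of a round need only be studied for the
  holder of \<open>A\<close>.\<close>

lemma sep_swap:
  assumes "sep N A K \<psi>" "A \<subseteq> {0..<N}"
  shows "sep N ({0..<N} - A) K (\<lambda>y x. \<psi> x y)"
  using assms(1)
proof (induction rule: sep.induct)
  case (zero \<psi>)
  then show ?case by (auto intro: sep.zero)
next
  case (add K \<phi> a b \<psi>)
  have "{0..<N} - ({0..<N} - A) = A" using assms(2) by auto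
  moreover have "z \<inter> ({0..<N} - A) = z - A" "z - ({0..<N} - A) = z \<inter> A" if "z \<subseteq> {0..<N}" for z
    using that assms(2) by auto
  ultimately show ?case
    using add by (intro sep.add[where a = b and b = a, OF add.IH]) (auto simp: mult.commute)
qed

text \<open>A local operator changes only the factor on \<open>A\<close>, and as an isometry it
  preserves the norm of that factor; the number of products stays the same.\<close>

lemma sep_apply_op:
  assumes "sep N A K \<psi>" and A: "A \<subseteq> {0..<N}" and U: "unitary_op N U" "acts_on N A U"
  shows "sep N A K (\<lambda>x y. apply_op N U (\<psi> x y))"
proof -
  obtain u where u: "\<And>z y. z \<subseteq> {0..<N} \<Longrightarrow> y \<subseteq> {0..<N} \<Longrightarrow>
      U z y = (if z - A = y - A then u (z \<inter> A) (y \<inter> A) else 0)"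
    using U(2) unfolding acts_on_def basis_states_def by auto
  have uU: "U z y = u z y" if "z \<subseteq> A" "y \<subseteq> A" for z y
  proof -
    have "z - A = y - A" "z \<inter> A = z" "y \<inter> A = y" using that by auto
    then show ?thesis using that A u[of z y] by (simp add: subset_trans[OF _ A])
  qed
  \<comment> \<open>The local matrix \<open>u\<close> inherits the isometry property from the
    columns of \<open>U\<close> whose qubits outside \<open>A\<close> are all 0: such columns vanish
    in rows not contained in \<open>A\<close>.\<close>
  have iso: "(\<Sum>z\<in>Pow A. cnj (u z x) * u z y) = (if x = y then 1 else 0)"
    if "x \<in> Pow A" "y \<in> Pow A" for x y
  proof -
    have "(\<Sum>z\<in>Pow A. cnj (u z x) * u z y) = (\<Sum>z\<in>Pow A. cnj (U z x) * U z y)"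
      using that by (intro sum.cong) (auto simp: uU)
    also have "\<dots> = (\<Sum>z\<in>basis_states N. cnj (U z x) * U z y)"
    proof (rule sum.mono_neutral_left)
      show "\<forall>z\<in>basis_states N - Pow A. cnj (U z x) * U z y = 0"
      proof
        fix z assume "z \<in> basis_states N - Pow A"
        then have "z \<subseteq> {0..<N}" "z - A \<noteq> x - A" "x \<subseteq> {0..<N}"
          using that A by (auto simp: basis_states_def)
        then show "cnj (U z x) * U z y = 0" by (simp add: u)
      qed
    qed (use A in \<open>auto simp: basis_states_def\<close>)
    also have "\<dots> = (if x = y then 1 else 0)"
      using U(1) that A unfolding unitary_op_def by (auto simp: basis_states_def)
    finally show ?thesis .
  qed
  have finA: "finite A" using A finite_subset by blast
  show ?thesis using assms(1)
  proof (induction rule: sep.induct)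
    case (zero \<psi>)
    then show ?case by (intro sep.zero) (simp add: apply_op_def basis_states_def)
  next
    case (add K \<phi> a b \<psi>)
    define a' where "a' = (\<lambda>x z. \<Sum>y\<in>Pow A. u z y * a x y)"
    show ?case
    proof (rule sep.add[where a = a' and b = b, OF add.IH])
      show "(\<Sum>z\<in>Pow A. (cmod (a' x z))\<^sup>2) \<le> 1" for x
        unfolding a'_def using add.hyps(2) finA by (subst isometry_norm) (auto simp: iso)
      show "(\<Sum>v\<in>Pow ({0..<N} - A). (cmod (b y v))\<^sup>2) \<le> 1" for y
        by (rule add.hyps)
      fix x y z assume z: "z \<subseteq> {0..<N}"
      have "apply_op N U (\<psi> x y) z
          = apply_op N U (\<phi> x y) z + (\<Sum>w\<in>Pow {0..<N}. U z w * (a x (w \<inter> A) * b y (w - A)))"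
        by (simp add: apply_op_def basis_states_def add.hyps(4) sum.distrib[symmetric] distrib_left)
      also have "(\<Sum>w\<in>Pow {0..<N}. U z w * (a x (w \<inter> A) * b y (w - A)))
          = (\<Sum>s\<in>Pow A. \<Sum>v\<in>Pow ({0..<N} - A). U z (s \<union> v) * (a x ((s \<union> v) \<inter> A) * b y ((s \<union> v) - A)))"
        by (rule sum_Pow_split) (use A in auto)
      also have "\<dots> = (\<Sum>s\<in>Pow A. \<Sum>v\<in>Pow ({0..<N} - A).
          if v = z - A then u (z \<inter> A) s * a x s * b y (z - A) else 0)"
      proof (intro sum.cong refl)
        fix s v assume sv: "s \<in> Pow A" "v \<in> Pow ({0..<N} - A)"
        then have "(s \<union> v) \<inter> A = s" "(s \<union> v) - A = v" "s \<union> v \<subseteq> {0..<N}" using A by auto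
        then show "U z (s \<union> v) * (a x ((s \<union> v) \<inter> A) * b y ((s \<union> v) - A))
            = (if v = z - A then u (z \<inter> A) s * a x s * b y (z - A) else 0)"
          using u[OF z, of "s \<union> v"] by (auto simp: mult_ac)
      qed
      also have "\<dots> = a' x (z \<inter> A) * b y (z - A)"
        using z by (auto simp: a'_def sum_distrib_right intro!: sum.cong)
      finally show "apply_op N U (\<psi> x y) z = apply_op N U (\<phi> x y) z + a' x (z \<inter> A) * b y (z - A)" .
    qed
  qed
qed

text \<open>Handing over a qubit splits every product according to the value of that qubit.\<close>
lemma sep_send:
  assumes "sep N A K \<psi>" and A: "A \<subseteq> {0..<N}" and q: "q \<in> A"
  shows "sep N (A - {q}) (2 * K) \<psi>"
  using assms(1)
proof (induction rule: sep.induct)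
  case (zero \<psi>)
  then show ?case by (auto intro: sep.zero)
next
  case (add K \<phi> a b \<psi>)
  have finA: "finite A" using A finite_subset by blast
  \<comment> \<open>Index 0 or 1 is the value of \<open>q\<close>. The first factor forgets
    \<open>q\<close> and the second one records it; \<open>a0\<close> and \<open>a1\<close> share
    the norm of \<open>a\<close>, while \<open>b0\<close> and \<open>b1\<close> each keep that of
    \<open>b\<close>.\<close>
  define a0 where "a0 = (\<lambda>x u. a x u)"
  define a1 where "a1 = (\<lambda>x u. a x (insert q u))"
  define b0 where "b0 = (\<lambda>y v. if q \<in> v then 0 else b y v)"
  define b1 where "b1 = (\<lambda>y v. if q \<in> v then b y (v - {q}) else 0)"
  have qN: "q \<in> {0..<N}" using A q by auto
  have a_split: "(\<Sum>u\<in>Pow A. (cmod (a x u))\<^sup>2)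
      = (\<Sum>u\<in>Pow (A - {q}). (cmod (a0 x u))\<^sup>2) + (\<Sum>u\<in>Pow (A - {q}). (cmod (a1 x u))\<^sup>2)" for x
  proof -
    have "A - (A - {q}) = {q}" using q by auto
    moreover have "Pow {q} = {{}, {q}}" by auto
    ultimately show ?thesis
      using sum_Pow_split[of "A - {q}" A "\<lambda>u. (cmod (a x u))\<^sup>2"] finA
      by (auto simp: a0_def a1_def sum.distrib[symmetric])
  qed
  have b_split: "(\<Sum>v\<in>Pow ({0..<N} - (A - {q})). f v)
      = (\<Sum>v\<in>Pow ({0..<N} - A). f v) + (\<Sum>v\<in>Pow ({0..<N} - A). f (insert q v))" for f :: "nat set \<Rightarrow> real"
  proof -
    have "({0..<N} - (A - {q})) - ({0..<N} - A) = {q}" using q qN by auto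
    moreover have "Pow {q} = {{}, {q}}" by auto
    moreover have "{0..<N} - A \<subseteq> {0..<N} - (A - {q})" by auto
    ultimately show ?thesis
      using sum_Pow_split[of "{0..<N} - A" "{0..<N} - (A - {q})" f]
      by (auto simp: sum.distrib[symmetric])
  qed
  have b01: "(\<Sum>v\<in>Pow ({0..<N} - A). (cmod (b0 y v))\<^sup>2) = (\<Sum>v\<in>Pow ({0..<N} - A). (cmod (b y v))\<^sup>2)"
    "(\<Sum>v\<in>Pow ({0..<N} - A). (cmod (b1 y v))\<^sup>2) = 0"
    "(\<Sum>v\<in>Pow ({0..<N} - A). (cmod (b0 y (insert q v)))\<^sup>2) = 0"
    "(\<Sum>v\<in>Pow ({0..<N} - A). (cmod (b1 y (insert q v)))\<^sup>2) = (\<Sum>v\<in>Pow ({0..<N} - A). (cmod (b y v))\<^sup>2)" for y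
  proof -
    have "q \<notin> v" if "v \<in> Pow ({0..<N} - A)" for v using that q by auto
    then show "(\<Sum>v\<in>Pow ({0..<N} - A). (cmod (b0 y v))\<^sup>2) = (\<Sum>v\<in>Pow ({0..<N} - A). (cmod (b y v))\<^sup>2)"
      "(\<Sum>v\<in>Pow ({0..<N} - A). (cmod (b1 y v))\<^sup>2) = 0"
      "(\<Sum>v\<in>Pow ({0..<N} - A). (cmod (b0 y (insert q v)))\<^sup>2) = 0"
      "(\<Sum>v\<in>Pow ({0..<N} - A). (cmod (b1 y (insert q v)))\<^sup>2) = (\<Sum>v\<in>Pow ({0..<N} - A). (cmod (b y v))\<^sup>2)"
      by (auto simp: b0_def b1_def intro!: sum.cong sum.neutral)
  qed
  have "sep N (A - {q}) (Suc (2 * K)) (\<lambda>x y z. \<phi> x y z + a0 x (z \<inter> (A - {q})) * b0 y (z - (A - {q})))"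
  proof (rule sep.add[where a = a0 and b = b0, OF add.IH])
    show "(\<Sum>u\<in>Pow (A - {q}). (cmod (a0 x u))\<^sup>2) \<le> 1" for x
      using add.hyps(2)[of x] a_split[of x] sum_nonneg[of "Pow (A - {q})" "\<lambda>u. (cmod (a1 x u))\<^sup>2"]
      by simp
    show "(\<Sum>v\<in>Pow ({0..<N} - (A - {q})). (cmod (b0 y v))\<^sup>2) \<le> 1" for y
      using add.hyps(3)[of y] by (simp add: b_split b01)
  qed simp
  then have "sep N (A - {q}) (Suc (Suc (2 * K))) \<psi>"
  proof (rule sep.add[where a = a1 and b = b1])
    show "(\<Sum>u\<in>Pow (A - {q}). (cmod (a1 x u))\<^sup>2) \<le> 1" for x
      using add.hyps(2)[of x] a_split[of x] sum_nonneg[of "Pow (A - {q})" "\<lambda>u. (cmod (a0 x u))\<^sup>2"]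
      by simp
    show "(\<Sum>v\<in>Pow ({0..<N} - (A - {q})). (cmod (b1 y v))\<^sup>2) \<le> 1" for y
      using add.hyps(3)[of y] by (simp add: b_split b01)
    fix x y z assume z: "z \<subseteq> {0..<N}"
    show "\<psi> x y z = \<phi> x y z + a0 x (z \<inter> (A - {q})) * b0 y (z - (A - {q})) +
        a1 x (z \<inter> (A - {q})) * b1 y (z - (A - {q}))"
    proof (cases "q \<in> z")
      case True
      then have "insert q (z \<inter> (A - {q})) = z \<inter> A" "z - (A - {q}) - {q} = z - A" using q by auto
      with True show ?thesis using z q by (simp add: add.hyps(4) a1_def b0_def b1_def)
    next
      case False
      then have "z \<inter> (A - {q}) = z \<inter> A" "z - (A - {q}) = z - A" by auto
      with False show ?thesis using z q by (simp add: add.hyps(4) a0_def b0_def b1_def)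
    qed
  qed
  then show ?case by simp
qed

lemma sep_run_rounds:
  assumes "sep N A K \<psi>" "A \<subseteq> {0..<N}" "valid_rounds N A rs"
  shows "\<exists>A' \<subseteq> {0..<N}. sep N A' (2 ^ length rs * K) (\<lambda>x y. run_rounds N rs (\<psi> x y))"
  using assms
proof (induction rs arbitrary: A K \<psi>)
  case Nil
  then show ?case by auto
next
  case (Cons r rs)
  obtain p U q where r: "r = (p, U, q)" by (cases r)
  let ?A = "if p then A - {q} else insert q A"
  have "sep N ?A (2 * K) (\<lambda>x y. apply_op N U (\<psi> x y))"
  proof (cases p)
    case True
    then show ?thesis using Cons.prems by (auto simp: r Let_def intro!: sep_send sep_apply_op)
  next
    case False
    \<comment> \<open>Bob's round is treated as a round of the first player on the complement; the
      swap is undone after the transfer.\<close>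
    let ?B = "{0..<N} - A"
    have "sep N ?B K (\<lambda>y x. \<psi> x y)"
      by (rule sep_swap) (use Cons.prems in auto)
    then have "sep N (?B - {q}) (2 * K) (\<lambda>y x. apply_op N U (\<psi> x y))"
      by (intro sep_send sep_apply_op) (use Cons.prems False in \<open>auto simp: r Let_def\<close>)
    then have "sep N ({0..<N} - (?B - {q})) (2 * K) (\<lambda>x y. apply_op N U (\<psi> x y))"
      by (rule sep_swap) auto
    also have "{0..<N} - (?B - {q}) = ?A"
      using False Cons.prems by (auto simp: r Let_def)
    finally show ?thesis .
  qed
  moreover have "?A \<subseteq> {0..<N}" "valid_rounds N ?A rs"
    using Cons.prems by (auto simp: r Let_def)
  ultimately show ?case
    using Cons.IH[of ?A "2 * K"] by (simp add: r mult_ac)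
qed

text \<open>The sum over basis states splits into a sum over \<open>A\<close> times a sum over its
  complement. Each is an inner product of vectors of norm at most 1, restricted by a 0/1
  weight.\<close>

lemma sep_inner_rank_one:
  assumes A: "A \<subseteq> {0..<N}"
    and a: "\<And>x. (\<Sum>u\<in>Pow A. (cmod (a x u))\<^sup>2) \<le> 1" "\<And>x. (\<Sum>u\<in>Pow A. (cmod (a' x u))\<^sup>2) \<le> 1"
    and b: "\<And>y. (\<Sum>v\<in>Pow ({0..<N} - A). (cmod (b y v))\<^sup>2) \<le> 1"
      "\<And>y. (\<Sum>v\<in>Pow ({0..<N} - A). (cmod (b' y v))\<^sup>2) \<le> 1"
  shows "rect_rep 1 (\<lambda>x y. \<Sum>z\<in>{z\<in>basis_states N. (q \<in> z) = c}.
      cnj (a x (z \<inter> A) * b y (z - A)) * (a' x (z \<inter> A) * b' y (z - A)))"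
proof -
  \<comment> \<open>The measured qubit lies on one side only, so the outcome condition is a weight
    there and constantly 1 on the other side.\<close>
  define cA where "cA = (\<lambda>u. if q \<in> A \<and> (q \<in> u) \<noteq> c then 0 else 1 :: complex)"
  define cB where "cB = (\<lambda>v. if q \<notin> A \<and> (q \<in> v) \<noteq> c then 0 else 1 :: complex)"
  have bound: "cmod (\<Sum>u\<in>X. g u * (cnj (f u) * h u)) \<le> 1"
    if "(\<Sum>u\<in>X. (cmod (f u))\<^sup>2) \<le> 1" "(\<Sum>u\<in>X. (cmod (h u))\<^sup>2) \<le> 1" "\<And>u. cmod (g u) \<le> 1"
    for X :: "nat set set" and f g h
  proof -
    have "cmod (\<Sum>u\<in>X. g u * (cnj (f u) * h u)) \<le> (\<Sum>u\<in>X. cmod (g u) * (cmod (f u) * cmod (h u)))"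
      by (rule order_trans[OF norm_sum]) (simp add: norm_mult)
    also have "\<dots> \<le> (\<Sum>u\<in>X. 1 * (((cmod (f u))\<^sup>2 + (cmod (h u))\<^sup>2) / 2))"
      by (intro sum_mono mult_mono mult_le_half_sum_squares that(3)) auto
    also have "\<dots> \<le> 1"
      using that(1,2) by (simp add: sum.distrib sum_divide_distrib[symmetric])
    finally show ?thesis .
  qed
  have "(\<Sum>z\<in>{z\<in>basis_states N. (q \<in> z) = c}. cnj (a x (z \<inter> A) * b y (z - A)) * (a' x (z \<inter> A) * b' y (z - A)))
      = (\<Sum>u\<in>Pow A. cA u * (cnj (a x u) * a' x u)) * (\<Sum>v\<in>Pow ({0..<N} - A). cB v * (cnj (b y v) * b' y v))" for x y
  proof -
    let ?f = "\<lambda>z. if (q \<in> z) = c then cnj (a x (z \<inter> A) * b y (z - A)) * (a' x (z \<inter> A) * b' y (z - A)) else 0"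
    have "(\<Sum>z\<in>{z\<in>basis_states N. (q \<in> z) = c}. cnj (a x (z \<inter> A) * b y (z - A)) * (a' x (z \<inter> A) * b' y (z - A)))
      = (\<Sum>z\<in>Pow {0..<N}. ?f z)"
      unfolding basis_states_def by (rule sum.inter_filter) simp
    also have "\<dots> = (\<Sum>u\<in>Pow A. \<Sum>v\<in>Pow ({0..<N} - A). ?f (u \<union> v))"
      by (rule sum_Pow_split) (use A in auto)
    also have "\<dots> = (\<Sum>u\<in>Pow A. \<Sum>v\<in>Pow ({0..<N} - A). (cA u * (cnj (a x u) * a' x u)) * (cB v * (cnj (b y v) * b' y v)))"
    proof (intro sum.cong refl)
      fix u v assume uv: "u \<in> Pow A" "v \<in> Pow ({0..<N} - A)"
      then have "(u \<union> v) \<inter> A = u" "(u \<union> v) - A = v" by auto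
      moreover have "(q \<in> u \<union> v) = c \<longleftrightarrow> (if q \<in> A then (q \<in> u) = c else (q \<in> v) = c)"
        using uv by auto
      ultimately show "?f (u \<union> v) = (cA u * (cnj (a x u) * a' x u)) * (cB v * (cnj (b y v) * b' y v))"
        by (simp add: cA_def cB_def mult_ac)
    qed
    finally show ?thesis by (simp add: sum_product)
  qed
  then show ?thesis
    by (simp only:) (intro rect_rep_rank_one bound a b, auto simp: cA_def cB_def)
qed

text \<open>Expanding in both arguments pairs each product of \<open>\<psi>\<close> with each
  product of \<open>\<phi>\<close>.\<close>

lemma sep_inner:
  assumes "sep N A K \<psi>" "sep N A L \<phi>" and A: "A \<subseteq> {0..<N}"
  shows "rect_rep (K * L) (\<lambda>x y. \<Sum>z\<in>{z\<in>basis_states N. (q \<in> z) = c}. cnj (\<psi> x y z) * \<phi> x y z)"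
proof -
  let ?Z = "{z\<in>basis_states N. (q \<in> z) = c}"
  have Z: "z \<subseteq> {0..<N}" if "z \<in> ?Z" for z using that by (auto simp: basis_states_def)
  have inner: "rect_rep L (\<lambda>x y. \<Sum>z\<in>?Z. cnj (a x (z \<inter> A) * b y (z - A)) * \<phi> x y z)"
    if a: "\<And>x. (\<Sum>u\<in>Pow A. (cmod (a x u))\<^sup>2) \<le> 1"
      and b: "\<And>y. (\<Sum>v\<in>Pow ({0..<N} - A). (cmod (b y v))\<^sup>2) \<le> 1" for a b
    using assms(2)
  proof (induction rule: sep.induct)
    case (zero \<phi>)
    then have "(\<Sum>z\<in>?Z. cnj (a x (z \<inter> A) * b y (z - A)) * \<phi> x y z) = 0" for x y
      by (intro sum.neutral) (simp add: Z)
    then show ?case by (simp add: rect_rep.zero)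
  next
    case (add L \<phi> a' b' \<phi>')
    have eq: "(\<Sum>z\<in>?Z. cnj (a x (z \<inter> A) * b y (z - A)) * \<phi>' x y z)
      = (\<Sum>z\<in>?Z. cnj (a x (z \<inter> A) * b y (z - A)) * \<phi> x y z)
      + (\<Sum>z\<in>?Z. cnj (a x (z \<inter> A) * b y (z - A)) * (a' x (z \<inter> A) * b' y (z - A)))" for x y
      unfolding sum.distrib[symmetric]
      by (rule sum.cong) (simp_all add: add.hyps(4) Z distrib_left)
    show ?case
      unfolding eq Suc_eq_plus1
      by (rule rect_rep_add[OF add.IH]) (rule sep_inner_rank_one[where a = a and a' = a' and b = b and b' = b', OF A a add.hyps(2) b add.hyps(3)])
  qed
  show ?thesis using assms(1)
  proof (induction rule: sep.induct)
    case (zero \<psi>)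
    then have "(\<Sum>z\<in>?Z. cnj (\<psi> x y z) * \<phi> x y z) = 0" for x y
      by (intro sum.neutral) (simp add: Z)
    then show ?case by (simp add: rect_rep.zero)
  next
    case (add K \<psi> a b \<psi>')
    have eq: "(\<Sum>z\<in>?Z. cnj (\<psi>' x y z) * \<phi> x y z)
      = (\<Sum>z\<in>?Z. cnj (a x (z \<inter> A) * b y (z - A)) * \<phi> x y z) + (\<Sum>z\<in>?Z. cnj (\<psi> x y z) * \<phi> x y z)" for x y
      unfolding sum.distrib[symmetric]
      by (rule sum.cong) (simp_all add: add.hyps(4) Z distrib_right)
    show ?case
      unfolding eq mult_Suc
      by (rule rect_rep_add[OF _ add.IH]) (rule inner[of a b, OF add.hyps(2,3)])
  qed
qed

text \<open>The encodings \<open>f\<close> and \<open>g\<close> leave the index types free, so that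
  inputs can later be given as sets.\<close>

lemma sep_init_state:
  assumes "wf_protocol n P"
  shows "sep (nqubits P) (alice0 P) 1 (\<lambda>x y. init_state n (f x) (g y))"
proof -
  let ?N = "nqubits P" and ?A = "alice0 P"
  define X where "X = (\<lambda>x. {i. i < n \<and> f x ! i})"
  define Y where "Y = (\<lambda>y. {n + i | i. i < n \<and> g y ! i})"
  have wf: "2 * n \<le> ?N" "?A \<subseteq> {0..<?N}" "{0..<n} \<subseteq> ?A" "?A \<inter> {n..<2 * n} = {}"
    using assms by (auto simp: wf_protocol_def)
  have X: "X x \<subseteq> ?A" for x using wf(3) by (auto simp: X_def)
  have "Y y \<subseteq> {n..<2 * n}" for y by (auto simp: Y_def)
  then have Y: "Y y \<inter> ?A = {}" for y using wf(4) by blast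
  have "sep ?N ?A (Suc 0) (\<lambda>x y. init_state n (f x) (g y))"
  proof (rule sep.add[where \<phi> = "\<lambda>x y z. 0" and a = "\<lambda>x. basis_vec (X x)" and b = "\<lambda>y. basis_vec (Y y)"])
    show "sep ?N ?A 0 (\<lambda>x y z. 0)" by (rule sep.zero) simp
    have "(\<Sum>u\<in>B. (cmod (basis_vec v u))\<^sup>2) \<le> 1" if "finite B" for v B
    proof -
      have "(\<Sum>u\<in>B. (cmod (basis_vec v u))\<^sup>2) = (\<Sum>u\<in>B. if u = v then 1 else 0)"
        by (rule sum.cong) (auto simp: basis_vec_def)
      then show ?thesis using that by simp
    qed
    then show "(\<Sum>u\<in>Pow ?A. (cmod (basis_vec (X x) u))\<^sup>2) \<le> 1"
      "(\<Sum>v\<in>Pow ({0..<?N} - ?A). (cmod (basis_vec (Y y) v))\<^sup>2) \<le> 1" for x y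
      using finite_subset[OF wf(2)] by auto
    fix x y z
    have "z = X x \<union> Y y \<longleftrightarrow> z \<inter> ?A = X x \<and> z - ?A = Y y"
      using X[of x] Y[of y] by blast
    then show "init_state n (f x) (g y) z = 0 + basis_vec (X x) (z \<inter> ?A) * basis_vec (Y y) (z - ?A)"
      by (simp add: init_state_def basis_vec_def X_def Y_def)
  qed
  then show ?thesis by simp
qed

text \<open>A probability is the restricted inner product of the final state with itself, hence the
  square of \<open>2 ^ cost P\<close> terms.\<close>

lemma prob_output_rect_rep:
  assumes "wf_protocol n P"
  shows "rect_rep (4 ^ cost P) (\<lambda>x y. complex_of_real (prob_output n P (f x) (g y) c))"
proof -
  let ?N = "nqubits P"
  obtain A where A: "A \<subseteq> {0..<?N}"
    and "sep ?N A (2 ^ length (rounds P) * 1) (\<lambda>x y. run_rounds ?N (rounds P) (init_state n (f x) (g y)))"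
    using sep_run_rounds[OF sep_init_state[OF assms], of "rounds P" f g] assms
    by (auto simp: wf_protocol_def)
  then have "sep ?N A (2 ^ cost P) (\<lambda>x y. final_state n P (f x) (g y))"
    by (simp add: final_state_def cost_def)
  from sep_inner[OF this this A, of "meas P" c] show ?thesis
    by (simp add: prob_output_def complex_norm_square mult.commute power_mult_distrib[symmetric] del: of_real_power)
qed

section \<open>Conservation of norm and of total probability\<close>

lemma run_rounds_norm:
  assumes "valid_rounds N A rs"
  shows "(\<Sum>z\<in>basis_states N. (cmod (run_rounds N rs \<psi> z))\<^sup>2) = (\<Sum>z\<in>basis_states N. (cmod (\<psi> z))\<^sup>2)"
  using assms
proof (induction rs arbitrary: A \<psi>)
  case (Cons r rs)
  obtain p U q where r: "r = (p, U, q)" by (cases r)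
  have "(\<Sum>z\<in>basis_states N. (cmod (apply_op N U \<psi> z))\<^sup>2) = (\<Sum>z\<in>basis_states N. (cmod (\<psi> z))\<^sup>2)"
    unfolding apply_op_def
    by (rule isometry_norm) (use Cons.prems in \<open>auto simp: r Let_def unitary_op_def\<close>)
  then show ?case using Cons by (auto simp: r Let_def)
qed simp

lemma prob_output_nonneg: "0 \<le> prob_output n P x y c"
  unfolding prob_output_def by (intro sum_nonneg) auto

lemma prob_output_sum:
  assumes "wf_protocol n P"
  shows "prob_output n P x y c + prob_output n P x y (\<not> c) = 1"
proof -
  let ?N = "nqubits P"
  let ?s = "{i. i < n \<and> x ! i} \<union> {n + i | i. i < n \<and> y ! i}"
  have "prob_output n P x y c + prob_output n P x y (\<not> c)
    = (\<Sum>z\<in>basis_states ?N. (cmod (final_state n P x y z))\<^sup>2)"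
    unfolding prob_output_def
    by (subst sum.union_disjoint[symmetric]) (auto intro!: sum.cong)
  also have "\<dots> = (\<Sum>z\<in>basis_states ?N. (cmod (init_state n x y z))\<^sup>2)"
    unfolding final_state_def using assms run_rounds_norm by (auto simp: wf_protocol_def)
  also have "\<dots> = (\<Sum>z\<in>basis_states ?N. if z = ?s then 1 else 0)"
    by (rule sum.cong) (auto simp: init_state_def basis_vec_def)
  also have "\<dots> = 1"
    using assms by (auto simp: basis_states_def wf_protocol_def)
  finally show ?thesis .
qed

section \<open>Existence of protocols\<close>

definition id_op :: qop where
  "id_op z y = (if z = y then 1 else 0)"

text \<open>The control \<open>g\<close> reads only \<open>y - {q}\<close>, which flipping
  \<open>q\<close> leaves unchanged; the map is therefore an involution and the operator is
  unitary.\<close>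

definition xor_op :: "nat \<Rightarrow> (nat set \<Rightarrow> bool) \<Rightarrow> qop" where
  "xor_op q g z y = (if z = (if g (y - {q}) then sym_diff y {q} else y) then 1 else 0)"

lemma unitary_op_permutation:
  assumes "inj_on \<pi> (basis_states N)" "\<pi> ` basis_states N \<subseteq> basis_states N"
  shows "unitary_op N (\<lambda>z y. if z = \<pi> y then 1 else 0)"
  unfolding unitary_op_def
proof (intro ballI)
  fix x y assume xy: "x \<in> basis_states N" "y \<in> basis_states N"
  have "(\<Sum>z\<in>basis_states N. cnj (if z = \<pi> x then 1 else 0) * (if z = \<pi> y then 1 else 0))
      = (\<Sum>z\<in>basis_states N. if z = \<pi> x then (if \<pi> x = \<pi> y then 1 else 0) else (0 :: complex))"
    by (rule sum.cong) auto
  also have "\<dots> = (if \<pi> x = \<pi> y then 1 else 0)"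
    using xy assms(2) by auto
  also have "\<pi> x = \<pi> y \<longleftrightarrow> x = y"
    using xy assms(1) by (auto dest: inj_onD)
  finally show "(\<Sum>z\<in>basis_states N. cnj (if z = \<pi> x then 1 else 0) * (if z = \<pi> y then 1 else 0))
      = (if x = y then 1 else (0 :: complex))" .
qed

lemma unitary_id_op: "unitary_op N id_op"
  unfolding id_op_def[abs_def] by (rule unitary_op_permutation) auto

lemma acts_on_id_op: "acts_on N S id_op"
  unfolding acts_on_def id_op_def
  by (rule exI[of _ "\<lambda>z y. if z = y then 1 else 0"]) auto

lemma unitary_xor_op:
  assumes "q < N"
  shows "unitary_op N (xor_op q g)"
  unfolding xor_op_def[abs_def]
proof (rule unitary_op_permutation)
  let ?\<pi> = "\<lambda>y. if g (y - {q}) then sym_diff y {q} else y"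
  have "?\<pi> (?\<pi> y) = y" for y
  proof -
    have "sym_diff y {q} - {q} = y - {q}" by auto
    then show ?thesis by auto
  qed
  then show "inj_on ?\<pi> (basis_states N)" by (rule inj_on_inverseI)
  show "?\<pi> ` basis_states N \<subseteq> basis_states N"
    using assms by (auto simp: basis_states_def)
qed

lemma acts_on_all: "acts_on N {0..<N} U"
  unfolding acts_on_def
proof (rule exI[of _ U], intro ballI)
  fix z y assume "z \<in> basis_states N" "y \<in> basis_states N"
  then have "z - {0..<N} = y - {0..<N}" "z \<inter> {0..<N} = z" "y \<inter> {0..<N} = y"
    by (auto simp: basis_states_def)
  then show "U z y = (if z - {0..<N} = y - {0..<N} then U (z \<inter> {0..<N}) (y \<inter> {0..<N}) else 0)"
    by simp
qed

lemma apply_id_op: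
  assumes "s \<in> basis_states N"
  shows "apply_op N id_op (basis_vec s) = basis_vec s"
proof
  fix z
  have "apply_op N id_op (basis_vec s) z = (\<Sum>y\<in>basis_states N. if y = s then basis_vec s z else 0)"
    unfolding apply_op_def by (rule sum.cong) (auto simp: id_op_def basis_vec_def)
  then show "apply_op N id_op (basis_vec s) z = basis_vec s z" using assms by simp
qed

lemma apply_xor_op:
  assumes "s \<in> basis_states N" "q \<notin> s"
  shows "apply_op N (xor_op q g) (basis_vec s) = basis_vec (if g s then insert q s else s)"
proof
  fix z
  let ?t = "if g s then insert q s else s"
  have "s - {q} = s" "sym_diff s {q} = insert q s" using assms by auto
  then have t: "xor_op q g z s = basis_vec ?t z" by (simp add: xor_op_def basis_vec_def)
  have "apply_op N (xor_op q g) (basis_vec s) z = (\<Sum>y\<in>basis_states N. if y = s then basis_vec ?t z else 0)"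
    unfolding apply_op_def t[symmetric] by (rule sum.cong) (auto simp: basis_vec_def)
  then show "apply_op N (xor_op q g) (basis_vec s) z = basis_vec ?t z" using assms by simp
qed

definition send_all :: "nat list \<Rightarrow> qround list" where
  "send_all qs = map (\<lambda>q. (True, id_op, q)) qs"

lemma valid_send_all:
  assumes "distinct qs" "set qs \<subseteq> A"
  shows "valid_rounds N A (send_all qs @ rs) \<longleftrightarrow> valid_rounds N (A - set qs) rs"
  using assms
proof (induction qs arbitrary: A)
  case (Cons q qs)
  have "A - {q} - set qs = A - set (q # qs)" by auto
  moreover have "valid_rounds N (A - {q}) (send_all qs @ rs) \<longleftrightarrow> valid_rounds N (A - {q} - set qs) rs"
    using Cons.prems by (intro Cons.IH) auto
  ultimately show ?case using Cons.prems
    by (simp add: send_all_def unitary_id_op acts_on_id_op)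
qed (simp add: send_all_def)

lemma run_send_all:
  assumes "s \<in> basis_states N"
  shows "run_rounds N (send_all qs @ rs) (basis_vec s) = run_rounds N rs (basis_vec s)"
  by (induction qs) (simp_all add: send_all_def apply_id_op[OF assms])

text \<open>Alice hands her whole input to Bob, who computes \<open>f\<close> into the workspace qubit \<open>2 * n\<close>.
  Without a protocol the \<open>LEAST\<close> in the definition of \<open>BQC\<close> would be a junk value.\<close>
lemma computes_exists:
  assumes "n > 0"
  shows "\<exists>P. computes n P f"
proof -
  define g where "g = (\<lambda>s. f (map (\<lambda>i. i \<in> s) [0..<n]) (map (\<lambda>i. n + i \<in> s) [0..<n]))"
  \<comment> \<open>After \<open>n\<close> messages Bob holds every qubit, so any operator is local
    to him. His round must send a qubit too; qubit 0 serves for that, and the answer is read from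
    \<open>2 * n\<close>.\<close>
  define P where "P = \<lparr>nqubits = 2 * n + 1, alice0 = {0..<n},
    rounds = send_all [0..<n] @ [(False, xor_op (2 * n) g, 0)], meas = 2 * n\<rparr>"
  let ?N = "2 * n + 1"
  have "valid_rounds ?N {0..<n} (rounds P)"
    using assms by (simp add: P_def valid_send_all unitary_xor_op acts_on_all[of "Suc (2 * n)"])
  then have wf: "wf_protocol n P" by (auto simp: wf_protocol_def P_def)
  have "prob_output n P x y (\<not> f x y) = 0" if len: "length x = n" "length y = n" for x y
  proof -
    let ?s = "{i. i < n \<and> x ! i} \<union> {n + i | i. i < n \<and> y ! i}"
    have s: "?s \<in> basis_states ?N" "2 * n \<notin> ?s" by (auto simp: basis_states_def)
    have "map (\<lambda>i. i \<in> ?s) [0..<n] = x" "map (\<lambda>i. n + i \<in> ?s) [0..<n] = y"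
      using len by (auto intro!: nth_equalityI)
    then have "g ?s = f x y" by (simp add: g_def)
    then have "final_state n P x y = basis_vec (if f x y then insert (2 * n) ?s else ?s)"
      using s by (simp add: final_state_def P_def init_state_def run_send_all apply_xor_op)
    then show ?thesis
      using s(2) unfolding prob_output_def by (intro sum.neutral) (auto simp: basis_vec_def P_def)
  qed
  with wf have "computes n P f" by (simp add: computes_def)
  then show ?thesis ..
qed

lemma BQC_attained:
  assumes "n > 0"
  shows "\<exists>P. computes n P f \<and> cost P = BQC n f"
proof -
  have "\<exists>k P. computes n P f \<and> cost P = k" using computes_exists[OF assms] by blast
  from LeastI_ex[OF this] show ?thesis unfolding BQC_def .
qed

section \<open>The lower bound\<close>

lemma HAM_protocol_bound:
  assumes m: "m > 0" and P: "computes (2 * m) P (HAM (2 * m) m)"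
    and e: "(8 / 9) ^ e * (4 * (real m + 1)\<^sup>2) \<le> 1"
  shows "2 ^ m \<le> 4 * (real m + 1)\<^sup>2 * 2 ^ ((2 * cost P + 1) * (2 * e))"
proof -
  let ?n = "2 * m"
  define l where "l = (\<lambda>S. map (\<lambda>i. i \<in> S) [0..<?n])"
  define p where "p = (\<lambda>c S T. prob_output ?n P (l S) (l T) c)"
  have wf: "wf_protocol ?n P" using P by (simp add: computes_def)
  obtain L where L: "L \<le> (2 * 4 ^ cost P) ^ (2 * e)"
    and rep: "rect_rep L (\<lambda>S T. majority_poly e (complex_of_real (p False S T)) (of_real (p True S T)))"
    using rect_rep_majority_poly[OF prob_output_rect_rep prob_output_rect_rep, OF wf wf, of e l l False l l True]
    unfolding p_def by blast
  have HAM: "HAM ?n m (l S) (l T) \<longleftrightarrow> card (sym_diff S T) \<noteq> m"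
    if "S \<subseteq> {..<?n}" "T \<subseteq> {..<?n}" for S T
  proof -
    have "{i. i < ?n \<and> l S ! i \<noteq> l T ! i} = sym_diff S T"
      using that by (auto simp: l_def)
    then show ?thesis by (simp add: HAM_def)
  qed
  have err: "p (\<not> HAM ?n m (l S) (l T)) S T \<le> 1 / 3" for S T
    using P by (simp add: computes_def p_def l_def)
  have p: "0 \<le> p c S T" "p False S T + p True S T = 1" for c S T
    using prob_output_sum[OF wf, of _ _ False] by (simp_all add: p_def prob_output_nonneg)
  have "2 ^ m \<le> 4 * (real m + 1)\<^sup>2 * real L"
  \<comment> \<open>Output \<open>False\<close> counts as success, because \<open>HAM\<close> is
    false exactly at distance \<open>m\<close>; the majority polynomial then approximates the
    indicator of the middle layer.\<close>
  proof (rule middle_layer_rank_bound[OF m _ _ e])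
    show "rect_rep L (\<lambda>S T. complex_of_real (majority_poly e (p False S T) (p True S T)))"
      using rep by (simp add: majority_poly_def)
    show "\<bar>majority_poly e (p False S T) (p True S T) - (if card (sym_diff S T) = m then 1 else 0)\<bar> \<le> (8 / 9) ^ e"
      if "S \<subseteq> {..<?n}" "T \<subseteq> {..<?n}" for S T
      using err[of S T] HAM[OF that] p
        majority_poly_large[of "p True S T" "p False S T" e]
        majority_poly_small[of "p False S T" "p True S T" e] by auto
  qed
  also have "\<dots> \<le> 4 * (real m + 1)\<^sup>2 * real ((2 * 4 ^ cost P) ^ (2 * e))"
    using L by (intro mult_left_mono of_nat_mono) auto
  also have "real ((2 * 4 ^ cost P) ^ (2 * e)) = (2 ^ (2 * cost P + 1)) ^ (2 * e)"
    by (simp add: power_mult)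
  also have "\<dots> = 2 ^ ((2 * cost P + 1) * (2 * e))"
    by (rule power_mult[symmetric])
  finally show ?thesis .
qed

text \<open>From \<open>ln x = 2 * ln (sqrt x) \<le> 2 * sqrt x\<close> and
  \<open>ln 2 \<ge> 1 / 2\<close> the logarithm is at most \<open>4 * sqrt x\<close>, and
  \<open>256 * 4 = 1024 \<le> sqrt x\<close>.\<close>

lemma log_mult_le_self:
  fixes x :: real
  assumes "x \<ge> 1024\<^sup>2"
  shows "256 * log 2 x \<le> x"
proof -
  have x: "x > 0" using assms by simp
  have s: "1024 \<le> sqrt x" using assms by (simp add: real_le_rsqrt)
  have "ln x = 2 * ln (sqrt x)" using x by (simp add: ln_sqrt)
  also have "\<dots> \<le> 2 * sqrt x" using ln_le_minus_one[of "sqrt x"] x by simp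
  finally have "log 2 x \<le> 2 * sqrt x / ln 2" by (simp add: log_def divide_right_mono)
  also have "\<dots> \<le> 2 * sqrt x / (1 / 2)"
  proof (rule divide_left_mono)
    show "1 / 2 \<le> ln (2 :: real)" using ln_le_minus_one[of "1 / 2"] by (simp add: ln_div)
  qed (use x in auto)
  finally have "256 * log 2 x \<le> 1024 * sqrt x" by simp
  also have "\<dots> \<le> sqrt x * sqrt x" using s x by (intro mult_right_mono) auto
  finally show ?thesis using x by simp
qed

theorem theorem5p2:
  shows "\<exists>c > 0. \<exists>n0. \<forall>n \<ge> n0. even n \<longrightarrow>
           real (BQC n (HAM n (n div 2))) \<ge> c * real n / log 2 (real n)"
proof -
  have "1 / 480 * real n / log 2 (real n) \<le> real (BQC n (HAM n (n div 2)))"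
    if n: "n \<ge> 1024\<^sup>2" "even n" for n :: nat
  proof -
    define m where "m = n div 2"
    have nm: "n = 2 * m" using n by (simp add: m_def)
    have m: "m \<ge> 2" using n nm by (simp add: power2_eq_square)
    obtain P where P: "computes n P (HAM n m)" and c: "cost P = BQC n (HAM n m)"
      using BQC_attained[of n "HAM n m"] nm m by force
    define lg where "lg = log 2 (real n)"
    have n1: "real n \<ge> 2" using nm m by simp
    have lg1: "lg \<ge> 1" using n1 by (simp add: lg_def le_log_iff)
    have big: "256 * lg \<le> real n"
      unfolding lg_def using n(1) by (intro log_mult_le_self) (simp flip: of_nat_power)
    \<comment> \<open>Chosen so that \<open>2 ^ k\<close> exceeds
      \<open>4 * (real m + 1) ^ 2\<close>, which is at most \<open>n ^ 4\<close>. Taking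
      \<open>e = 6 * k\<close> suffices for the error because
      \<open>(8 / 9) ^ 6 < 1 / 2\<close>.\<close>
    define k where "k = nat \<lceil>4 * lg\<rceil>"
    define E where "E = (2 * cost P + 1) * (2 * (6 * k))"
    have k: "4 * lg \<le> real k" "real k \<le> 5 * lg"
      using lg1 by (auto simp: k_def) linarith
    have "4 * (real m + 1)\<^sup>2 = (real n + 2)\<^sup>2" by (simp add: nm power2_eq_square algebra_simps)
    also have "\<dots> \<le> (real n * real n)\<^sup>2"
    proof (rule power_mono)
      have "2 * real n \<le> real n * real n" using n1 by (intro mult_right_mono) auto
      then show "real n + 2 \<le> real n * real n" using n1 by linarith
    qed simp
    also have "\<dots> = 2 powr (4 * lg)"
    proof -
      have "2 powr (4 * lg) = real n powr 4"
        using n1 by (simp add: lg_def powr_powr[symmetric] mult.commute[of 4])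
      then show ?thesis using n1 by (simp add: power2_eq_square power4_eq_xxxx mult_ac)
    qed
    finally have m4: "4 * (real m + 1)\<^sup>2 \<le> 2 powr (4 * lg)" .
    have "2 powr (4 * lg) \<le> 2 powr real k"
      using k by (intro powr_mono) auto
    also have "\<dots> = 2 ^ k" by (simp add: powr_realpow)
    finally have "4 * (real m + 1)\<^sup>2 \<le> 2 ^ k" using m4 by simp
    then have "(8 / 9) ^ (6 * k) * (4 * (real m + 1)\<^sup>2) \<le> (8 / 9) ^ (6 * k) * 2 ^ k"
      by (intro mult_left_mono) auto
    also have "\<dots> = ((8 / 9) ^ 6 * 2) ^ k" by (simp only: power_mult power_mult_distrib)
    also have "\<dots> \<le> 1" by (intro power_le_one) (auto simp: power_divide)
    finally have "2 ^ m \<le> 4 * (real m + 1)\<^sup>2 * 2 ^ E"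
      using P m unfolding nm E_def by (intro HAM_protocol_bound) auto
    also have "\<dots> \<le> 2 powr (4 * lg) * 2 ^ E"
      using m4 by (rule mult_right_mono) simp
    finally have "2 powr real m \<le> 2 powr (4 * lg + real E)"
      by (simp add: powr_realpow powr_add)
    then have "real m \<le> 4 * lg + real E"
      by simp
    also have "\<dots> = 4 * lg + 12 * ((2 * real (cost P) + 1) * real k)"
      by (simp add: E_def algebra_simps)
    also have "\<dots> \<le> 4 * lg + 12 * ((2 * real (cost P) + 1) * (5 * lg))"
      using k by (intro add_left_mono mult_left_mono) auto
    \<comment> \<open>The preceding bound gives \<open>n \<le> 240 * cost P * lg + 128 * lg\<close>,
      and \<open>big\<close> makes the last summand at most \<open>n / 2\<close>; this accounts for
      both 480 and 256.\<close>
    finally have "real n \<le> 480 * (real (cost P) * lg)"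
      using big by (simp add: nm algebra_simps)
    then show ?thesis
      using lg1 c by (simp add: lg_def[symmetric] m_def field_simps)
  qed
  then show ?thesis
    by (intro exI[of _ "1 / 480"] conjI exI[of _ "1024\<^sup>2"]) auto
qed

end
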